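(* Let $p$ be a prime number, and let $m\geq 2$ and $0\leq k\leq m$ be integers. (a) If $k\not\equiv p-1 \pmod p$, then $s_p(\Delta^m_{(k)})\geq 2$ if and only if $m\geq k+\left\lfloor\frac{k}{p}\right\rfloor+2$. (b) If $k\equiv p-1 \pmod p$, then $s_p(\Delta^m_{(k)})\geq 2$ if and only if $m\geq k+\left\lfloor\frac{k}{p}\right\rfloor+3$.
   Context: For a prime $p$ and an integer $n\ge 0$, the universal simplicial complex $X(\mathbb{F}_p^n)$ is the abstract simplicial complex whose vertices are the nonzero vectors of $\mathbb{F}_p^n$ and whose simplices are the sets of vectors that are linearly independent over $\mathbb{F}_p$. A simplicial map is nondegenerate if it is injective on the vertex set of every simplex (equivalently, it maps every $j$-simplex onto a $j$-simplex). For a finite simplicial complex $\mathcal{K}$ with $N$ vertices, the mod $p$ Buchstaber invariant of $\mathcal{K}$ is the integer $s_p(\mathcal{K})=N-r$, where $r$ is the least integer such that there is a nondegenerate simplicial map $\mathcal{K}\to X(\mathbb{F}_p^r)$. $\Delta^m$ is the $m$-simplex on the vertex set $\{1,\ldots,m+1\}$, and $\Delta^m_{(k)}$ is its $k$-skeleton, i.e. the simplices are the subsets of $\{1,\ldots,m+1\}$ with at most $k+1$ elements. *)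

theory Defs
  imports "HOL-Number_Theory.Residues" "Jordan_Normal_Form.Missing_VectorSpace"
begin

section \<open>Abstract simplicial complexes\<close>

text \<open>A complex is given by its family of simplices: a family of finite sets closed under taking
  subsets. The empty simplex is allowed. The vertices are the points occurring in some simplex.\<close>

definition simplicial_complex :: "'a set set \<Rightarrow> bool" where
  "simplicial_complex \<K> \<longleftrightarrow>
     (\<forall>\<sigma>\<in>\<K>. finite \<sigma>) \<and> (\<forall>\<sigma>\<in>\<K>. \<forall>\<tau>. \<tau> \<subseteq> \<sigma> \<longrightarrow> \<tau> \<in> \<K>)"

definition vertices :: "'a set set \<Rightarrow> 'a set" where
  "vertices \<K> = \<Union>\<K>"

definition simplicial_map :: "'a set set \<Rightarrow> 'b set set \<Rightarrow> ('a \<Rightarrow> 'b) \<Rightarrow> bool" where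
  "simplicial_map \<K> \<L> f \<longleftrightarrow> f \<in> vertices \<K> \<rightarrow> vertices \<L> \<and> (\<forall>\<sigma>\<in>\<K>. f ` \<sigma> \<in> \<L>)"

definition nondegenerate_map :: "'a set set \<Rightarrow> 'b set set \<Rightarrow> ('a \<Rightarrow> 'b) \<Rightarrow> bool" where
  "nondegenerate_map \<K> \<L> f \<longleftrightarrow> simplicial_map \<K> \<L> f \<and> (\<forall>\<sigma>\<in>\<K>. inj_on f \<sigma>)"

text \<open>The \<open>k\<close>-skeleton of the \<open>m\<close>-simplex on the vertex set \<open>{1, \<dots>, m + 1}\<close>.\<close>

definition simplex_skeleton :: "nat \<Rightarrow> nat \<Rightarrow> nat set set" where
  "simplex_skeleton m k = {\<sigma>. \<sigma> \<subseteq> {1..m + 1} \<and> card \<sigma> \<le> k + 1}"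


section \<open>The universal complexes and the Buchstaber invariant\<close>

text \<open>The space of \<open>n\<close>-tuples over \<open>\<int>/p\<int>\<close>, encoded as (extensional) functions on the
  index set \<open>{0, \<dots>, n - 1}\<close> with componentwise operations.\<close>

abbreviation Fp_space :: "nat \<Rightarrow> nat \<Rightarrow> (int, nat \<Rightarrow> int) module" where
  "Fp_space p n \<equiv> ring.func_space (residue_ring (int p)) {..<n}"

definition universal_complex :: "nat \<Rightarrow> nat \<Rightarrow> (nat \<Rightarrow> int) set set" where
  "universal_complex p n =
     {S. S \<subseteq> carrier (Fp_space p n) - {\<zero>\<^bsub>Fp_space p n\<^esub>} \<and>
         \<not> LinearCombinations.module.lin_dep (residue_ring (int p)) (Fp_space p n) S}"

definition buchstaber_mod :: "nat \<Rightarrow> 'a set set \<Rightarrow> int" where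
  "buchstaber_mod p \<K> = int (card (vertices \<K>)) -
     int (LEAST r. \<exists>f. nondegenerate_map \<K> (universal_complex p r) f)"


text \<open>The underlying structures are what they should be, so that \<open>lin_dep\<close> above is linear
  dependence over a field, and the least \<open>r\<close> is attained.\<close>

lemma vectorspace_Fp:
  assumes "prime p"
  shows "vectorspace (residue_ring (int p)) (Fp_space p n)"
proof -
  have "residues_prime p"
    using assms by unfold_locales
  then have F: "Ring.field (residue_ring (int p))"
    by (rule residues_prime.is_field)
  then show ?thesis
    unfolding vectorspace_def
    by (simp add: cring.func_space_is_module fieldE(1))
qed

lemma carrier_Fp: "prime p \<Longrightarrow> carrier (Fp_space p n) = {..<n} \<rightarrow>\<^sub>E {0..int p - 1}"
  and zero_Fp: "prime p \<Longrightarrow> \<zero>\<^bsub>Fp_space p n\<^esub> = (\<lambda>i\<in>{..<n}. 0)"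
  and add_Fp: "prime p \<Longrightarrow> v \<oplus>\<^bsub>Fp_space p n\<^esub> w = (\<lambda>i\<in>{..<n}. (v i + w i) mod int p)"
  and smult_Fp: "prime p \<Longrightarrow> c \<odot>\<^bsub>Fp_space p n\<^esub> v = (\<lambda>i\<in>{..<n}. (c * v i) mod int p)"
proof -
  assume "prime p"
  then interpret V: vectorspace "residue_ring (int p)" "Fp_space p n"
    by (rule vectorspace_Fp)
  show "carrier (Fp_space p n) = {..<n} \<rightarrow>\<^sub>E {0..int p - 1}"
    "\<zero>\<^bsub>Fp_space p n\<^esub> = (\<lambda>i\<in>{..<n}. 0)"
    "v \<oplus>\<^bsub>Fp_space p n\<^esub> w = (\<lambda>i\<in>{..<n}. (v i + w i) mod int p)"
    "c \<odot>\<^bsub>Fp_space p n\<^esub> v = (\<lambda>i\<in>{..<n}. (c * v i) mod int p)"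
    unfolding ring.func_space_def[OF V.R.ring_axioms] by (simp_all add: residue_ring_def)
qed

lemma simplicial_complex_skeleton: "simplicial_complex (simplex_skeleton m k)"
proof -
  have "finite \<sigma>" if "\<sigma> \<in> simplex_skeleton m k" for \<sigma>
    using that finite_subset[of \<sigma> "{1..m + 1}"] by (simp add: simplex_skeleton_def)
  moreover have "\<tau> \<in> simplex_skeleton m k" if "\<sigma> \<in> simplex_skeleton m k" "\<tau> \<subseteq> \<sigma>" for \<sigma> \<tau>
    using that card_mono[of \<sigma> \<tau>] calculation[of \<sigma>] by (auto simp: simplex_skeleton_def)
  ultimately show ?thesis
    unfolding simplicial_complex_def by blast
qed

lemma vertices_skeleton: "vertices (simplex_skeleton m k) = {1..m + 1}"
proof -
  have "{i} \<in> simplex_skeleton m k" if "i \<in> {1..m + 1}" for i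
    using that by (auto simp: simplex_skeleton_def)
  moreover have "\<sigma> \<subseteq> {1..m + 1}" if "\<sigma> \<in> simplex_skeleton m k" for \<sigma>
    using that by (simp add: simplex_skeleton_def)
  ultimately show ?thesis
    unfolding vertices_def by blast
qed

lemma simplicial_complex_universal:
  assumes "prime p"
  shows "simplicial_complex (universal_complex p n)"
proof -
  interpret V: vectorspace "residue_ring (int p)" "Fp_space p n"
    using assms by (rule vectorspace_Fp)
  have fin: "finite (carrier (Fp_space p n))"
    by (simp add: carrier_Fp[OF assms] finite_PiE)
  show ?thesis
    unfolding simplicial_complex_def universal_complex_def
    using V.subset_li_is_li finite_subset[OF _ fin] by blast
qed

lemma lincomb_Fp:
  assumes "prime p" "finite A" "A \<subseteq> carrier (Fp_space p n)"
    and "a \<in> A \<rightarrow> carrier (residue_ring (int p))"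
  shows "LinearCombinations.module.lincomb (Fp_space p n) a A =
           (\<lambda>i\<in>{..<n}. (\<Sum>v\<in>A. a v * v i) mod int p)"
proof -
  interpret V: vectorspace "residue_ring (int p)" "Fp_space p n"
    using assms(1) by (rule vectorspace_Fp)
  note Fp = zero_Fp[OF assms(1)] add_Fp[OF assms(1)] smult_Fp[OF assms(1)]
  show ?thesis
    using assms(2-)
  proof (induction A rule: finite_induct)
    case empty
    show ?case by (simp add: V.lincomb_def Fp)
  next
    case (insert w A)
    have "V.lincomb a (insert w A) = a w \<odot>\<^bsub>Fp_space p n\<^esub> w \<oplus>\<^bsub>Fp_space p n\<^esub> V.lincomb a A"
      using insert.hyps insert.prems unfolding V.lincomb_def
      by (intro V.M.finsum_insert) auto
    also have "V.lincomb a A = (\<lambda>i\<in>{..<n}. (\<Sum>v\<in>A. a v * v i) mod int p)"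
      using insert.IH insert.prems by fastforce
    finally show ?case
      using insert.hyps by (auto simp: Fp mod_simps)
  qed
qed

lemma vertices_universal:
  assumes "prime p"
  shows "vertices (universal_complex p n) = carrier (Fp_space p n) - {\<zero>\<^bsub>Fp_space p n\<^esub>}"
proof -
  interpret V: vectorspace "residue_ring (int p)" "Fp_space p n"
    using assms by (rule vectorspace_Fp)
  have "{v} \<in> universal_complex p n"
    if v: "v \<in> carrier (Fp_space p n)" "v \<noteq> \<zero>\<^bsub>Fp_space p n\<^esub>" for v
  proof -
    have "\<not> V.lin_dep {v}"
      using V.lindep_span[of "{v}"] v V.span_empty by auto
    then show ?thesis
      using v by (simp add: universal_complex_def)
  qed
  moreover have "S \<subseteq> carrier (Fp_space p n) - {\<zero>\<^bsub>Fp_space p n\<^esub>}" if "S \<in> universal_complex p n" for S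
    using that unfolding universal_complex_def by blast
  ultimately show ?thesis
    unfolding vertices_def by fast
qed

lemma ex_nondegenerate_map:
  fixes \<K> :: "'a set set"
  assumes "prime p" "simplicial_complex \<K>" "finite (vertices \<K>)"
  shows "\<exists>r f. nondegenerate_map \<K> (universal_complex p r) f"
proof -
  define n where "n = card (vertices \<K>)"
  obtain e where e: "bij_betw e (vertices \<K>) {..<n}"
    using ex_bij_betw_finite_nat[OF assms(3)] unfolding n_def atLeast0LessThan by blast
  interpret V: vectorspace "residue_ring (int p)" "Fp_space p n"
    using assms(1) by (rule vectorspace_Fp)
  define f where "f x = (\<lambda>i\<in>{..<n}. if i = e x then 1 else 0 :: int)" for x
  have p: "p > 1" using assms(1) by (rule prime_gt_1_nat)
  have f_carrier: "f x \<in> carrier (Fp_space p n)" for x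
    using p by (auto simp: carrier_Fp[OF assms(1)] f_def)
  have e_less: "e x < n" if "x \<in> vertices \<K>" for x
    using e that by (auto simp: bij_betw_def)
  have f_e: "f x (e y) = (if x = y then 1 else 0)" if "x \<in> vertices \<K>" "y \<in> vertices \<K>" for x y
    using e that e_less by (auto simp: f_def bij_betw_def inj_on_def)
  have f_inj: "inj_on f (vertices \<K>)"
    by (rule inj_onI) (metis f_e zero_neq_one)
  have f_nz: "f x \<noteq> \<zero>\<^bsub>Fp_space p n\<^esub>" if "x \<in> vertices \<K>" for x
    using f_e[OF that that] e_less[OF that] by (auto simp: zero_Fp[OF assms(1)])
  have indep: "\<not> V.lin_dep (f ` \<sigma>)" if "\<sigma> \<in> \<K>" for \<sigma>
  proof
    have \<sigma>: "\<sigma> \<subseteq> vertices \<K>" using that by (auto simp: vertices_def)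
    assume "V.lin_dep (f ` \<sigma>)"
    then obtain A a v where A: "finite A" "A \<subseteq> f ` \<sigma>" "a \<in> A \<rightarrow> carrier (residue_ring (int p))"
      and 0: "V.lincomb a A = \<zero>\<^bsub>Fp_space p n\<^esub>" and v: "v \<in> A" "a v \<noteq> \<zero>\<^bsub>residue_ring (int p)\<^esub>"
      unfolding V.lin_dep_def by blast
    have AC: "A \<subseteq> carrier (Fp_space p n)" using A(2) f_carrier by auto
    obtain x where x: "x \<in> \<sigma>" "v = f x" using A(2) v(1) by auto
    have w: "w (e x) = (if w = v then 1 else 0)" if wA: "w \<in> A" for w
    proof -
      obtain y where "y \<in> \<sigma>" "w = f y" using A(2) wA by blast
      then show ?thesis
        using x \<sigma> f_e[of y x] f_inj by (auto simp: inj_on_def subset_iff)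
    qed
    have "(\<Sum>w\<in>A. a w * w (e x)) = (\<Sum>w\<in>A. if w = v then a w else 0)"
      by (rule sum.cong) (auto simp: w)
    also have "\<dots> = a v" using A(1) v(1) by simp
    finally have "a v mod int p = V.lincomb a A (e x)"
      using e_less[of x] x(1) \<sigma> by (simp add: lincomb_Fp[OF assms(1) A(1) AC A(3)] subset_iff)
    also have "\<dots> = 0"
      using e_less[of x] x(1) \<sigma> unfolding 0 by (simp add: zero_Fp[OF assms(1)] subset_iff)
    finally show False
      using A(3) v by (auto simp: residue_ring_def Pi_iff)
  qed
  have "nondegenerate_map \<K> (universal_complex p n) f"
    unfolding nondegenerate_map_def simplicial_map_def vertices_universal[OF assms(1)]
  proof (intro conjI ballI)
    show "f \<in> vertices \<K> \<rightarrow> carrier (Fp_space p n) - {\<zero>\<^bsub>Fp_space p n\<^esub>}"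
      using f_carrier f_nz by auto
  next
    fix \<sigma> assume "\<sigma> \<in> \<K>"
    then have "\<sigma> \<subseteq> vertices \<K>" by (auto simp: vertices_def)
    then show "inj_on f \<sigma>" using f_inj by (rule inj_on_subset[rotated])
    show "f ` \<sigma> \<in> universal_complex p n"
      using indep[OF \<open>\<sigma> \<in> \<K>\<close>] f_carrier f_nz \<open>\<sigma> \<subseteq> vertices \<K>\<close>
      by (auto simp: universal_complex_def)
  qed
  then show ?thesis by blast
qed

end

theory Submission
  imports Defs
begin

text \<open>
  The statement is the case of dimension two of the Griesmer bound from coding theory.

  A map \<open>f\<close> from the vertex set \<open>{1, \<dots>, m + 1}\<close> to \<open>\<int>/p\<int>\<close>-vectors of length \<open>r\<close> has a space of
  linear relations \<open>a\<close>, and \<open>f\<close> is nondegenerate on the \<open>k\<close>-skeleton exactly when no nonzero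
  relation is supported on at most \<open>k + 1\<close> vertices
  (\<open>nondegenerate_skeleton_iff_min_weight\<close>): the relations form a linear code of length \<open>m + 1\<close>
  and minimum distance at least \<open>k + 2\<close>, with \<open>f\<close> as its parity check matrix. The Buchstaber
  invariant is at least \<open>2\<close> if and only if one can take \<open>r \<le> m - 1\<close>, that is, if and only if there is
  such a code of dimension at least two. This happens exactly when
  \<open>(p + 1) (k + 2) \<le> p (m + 1)\<close>, and solving this inequality for \<open>m\<close> gives the two thresholds.

  The inequality is necessary (\<open>plotkin_bound\<close>) because two independent code words \<open>c\<close>, \<open>d\<close> span
  \<open>p + 1\<close> lines, represented by \<open>c\<close> and the words \<open>d + t c\<close>. At each of the \<open>m + 1\<close> positions at
  least one of these words vanishes, so their weights add up to at most \<open>p (m + 1)\<close>, whereas each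
  weight is at least \<open>k + 2\<close>.

  It is sufficient (\<open>ex_nondegenerate_of_bound\<close>) because a code of dimension two is a sequence of
  points of the plane, a code word being a linear form evaluated at the points. A nonzero form
  vanishes on only one of the \<open>p + 1\<close> lines, so the weights are largest when the points are
  distributed evenly over the lines, as is achieved by running through the lines cyclically.
\<close>

section \<open>Linear independence as a condition on weights\<close>

definition mod_relation :: "nat \<Rightarrow> nat \<Rightarrow> ('a \<Rightarrow> nat \<Rightarrow> int) \<Rightarrow> 'a set \<Rightarrow> ('a \<Rightarrow> int) \<Rightarrow> bool" where
  "mod_relation p r f \<sigma> a \<longleftrightarrow> (\<forall>j<r. int p dvd (\<Sum>x\<in>\<sigma>. a x * f x j))"

definition mod_support :: "nat \<Rightarrow> 'a set \<Rightarrow> ('a \<Rightarrow> int) \<Rightarrow> 'a set" where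
  "mod_support p \<sigma> a = {x\<in>\<sigma>. \<not> int p dvd a x}"

text \<open>Injectivity on a simplex and independence of its image together say that the images of the
  vertices are independent as a family; this form has coefficients indexed by the vertices.\<close>

lemma independent_family_iff:
  fixes \<sigma> :: "'a set"
  assumes p: "prime p" and fin: "finite \<sigma>" and fC: "f ` \<sigma> \<subseteq> carrier (Fp_space p r)"
  shows "inj_on f \<sigma> \<and> f ` \<sigma> \<in> universal_complex p r \<longleftrightarrow>
         (\<forall>a. mod_relation p r f \<sigma> a \<longrightarrow> (\<forall>x\<in>\<sigma>. int p dvd a x))" (is "?L \<longleftrightarrow> ?R")
proof -
  interpret V: vectorspace "residue_ring (int p)" "Fp_space p r"
    using p by (rule vectorspace_Fp)
  have p1: "p > 1" using p by (rule prime_gt_1_nat)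
  have carR: "carrier (residue_ring (int p)) = {0..int p - 1}"
    and zeroR: "\<zero>\<^bsub>residue_ring (int p)\<^esub> = 0"
    by (simp_all add: residue_ring_def)
  show ?thesis
  proof
    assume L: ?L
    then have inj: "inj_on f \<sigma>" and li: "\<not> V.lin_dep (f ` \<sigma>)"
      by (auto simp: universal_complex_def)
    show ?R
    proof (intro allI impI ballI)
      fix a x assume rel: "mod_relation p r f \<sigma> a" and x: "x \<in> \<sigma>"
      define b where "b v = a (inv_into \<sigma> f v) mod int p" for v
      have bf: "b (f y) = a y mod int p" if "y \<in> \<sigma>" for y
        using inj that by (simp add: b_def)
      have bC: "b \<in> f ` \<sigma> \<rightarrow> carrier (residue_ring (int p))"
        using p1 by (auto simp: b_def carR)
      have "(\<Sum>v\<in>f ` \<sigma>. b v * v j) mod int p = 0" if "j < r" for j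
      proof -
        have "(\<Sum>v\<in>f ` \<sigma>. b v * v j) = (\<Sum>y\<in>\<sigma>. (a y mod int p) * f y j)"
          by (simp add: sum.reindex[OF inj] bf)
        also have "\<dots> mod int p = (\<Sum>y\<in>\<sigma>. ((a y mod int p) * f y j) mod int p) mod int p"
          by (simp add: mod_sum_eq)
        also have "\<dots> = (\<Sum>y\<in>\<sigma>. a y * f y j) mod int p"
          by (simp add: mod_mult_left_eq mod_sum_eq)
        also have "\<dots> = 0"
          using rel that by (simp add: mod_relation_def)
        finally show ?thesis .
      qed
      then have "V.lincomb b (f ` \<sigma>) = \<zero>\<^bsub>Fp_space p r\<^esub>"
        by (auto simp: lincomb_Fp[OF p _ fC bC] fin zero_Fp[OF p])
      with li have "b (f x) = 0"
        using bC x fin unfolding V.lin_dep_def zeroR by blast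
      then show "int p dvd a x" using bf[OF x] by auto
    qed
  next
    assume R: ?R
    have no_unit: "\<not> mod_relation p r f \<sigma> a" if "x \<in> \<sigma>" "a x = 1" for a x
    proof
      assume "mod_relation p r f \<sigma> a"
      with R that have "int p dvd 1" by metis
      then show False using p1 by simp
    qed
    have inj: "inj_on f \<sigma>"
    proof (rule inj_onI, rule ccontr)
      fix x y assume xy: "x \<in> \<sigma>" "y \<in> \<sigma>" "f x = f y" "x \<noteq> y"
      define a :: "'a \<Rightarrow> int" where "a z = (if z = x then 1 else 0) - (if z = y then 1 else 0)" for z
      have "(\<Sum>z\<in>\<sigma>. a z * f z j) = f x j - f y j" for j
        using xy fin by (simp add: a_def left_diff_distrib sum_subtractf if_distrib[of "\<lambda>c. c * _"] cong: if_cong)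
      then have "mod_relation p r f \<sigma> a"
        using xy by (simp add: mod_relation_def)
      moreover have "a x = 1" using xy by (simp add: a_def)
      ultimately show False using no_unit xy(1) by blast
    qed
    have nz: "f x \<noteq> \<zero>\<^bsub>Fp_space p r\<^esub>" if x: "x \<in> \<sigma>" for x
    proof
      assume 0: "f x = \<zero>\<^bsub>Fp_space p r\<^esub>"
      define a :: "'a \<Rightarrow> int" where "a z = (if z = x then 1 else 0)" for z
      have "(\<Sum>z\<in>\<sigma>. a z * f z j) = f x j" for j
        using x fin by (simp add: a_def if_distrib[of "\<lambda>c. c * _"] cong: if_cong)
      then have "mod_relation p r f \<sigma> a"
        by (simp add: mod_relation_def 0 zero_Fp[OF p])
      then show False using no_unit[OF x, of a] by (simp add: a_def)
    qed
    have "\<not> V.lin_dep (f ` \<sigma>)"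
    proof
      assume "V.lin_dep (f ` \<sigma>)"
      then obtain A b v where A: "finite A" "A \<subseteq> f ` \<sigma>" "b \<in> A \<rightarrow> carrier (residue_ring (int p))"
        and 0: "V.lincomb b A = \<zero>\<^bsub>Fp_space p r\<^esub>" and v: "v \<in> A" "b v \<noteq> 0"
        unfolding V.lin_dep_def zeroR by blast
      define a where "a x = (if f x \<in> A then b (f x) else 0)" for x
      have "(\<Sum>x\<in>\<sigma>. a x * f x j) = (\<Sum>w\<in>A. b w * w j)" for j
      proof -
        have "(\<Sum>x\<in>\<sigma>. a x * f x j) = (\<Sum>w\<in>f ` \<sigma>. (if w \<in> A then b w else 0) * w j)"
          by (simp add: sum.reindex[OF inj] a_def)
        also have "\<dots> = (\<Sum>w\<in>A. (if w \<in> A then b w else 0) * w j)"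
          using fin A(2) by (intro sum.mono_neutral_right) auto
        finally show ?thesis by simp
      qed
      moreover have "int p dvd (\<Sum>w\<in>A. b w * w j)" if "j < r" for j
        using fun_cong[OF 0, of j] that
        by (simp add: lincomb_Fp[OF p A(1) subset_trans[OF A(2) fC] A(3)] zero_Fp[OF p]
            mod_eq_0_iff_dvd)
      ultimately have "mod_relation p r f \<sigma> a"
        by (simp add: mod_relation_def)
      moreover obtain x where x: "x \<in> \<sigma>" "v = f x" using A(2) v(1) by auto
      ultimately have "int p dvd b v"
        using R v(1) by (auto simp: a_def dest!: spec[of _ a])
      moreover have "0 \<le> b v" "b v < int p"
        using A(3) v(1) by (force simp: carR Pi_iff)+
      ultimately show False using v(2) zdvd_imp_le[of "int p" "b v"] by simp
    qed
    with inj nz fC show ?L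
      by (auto simp: universal_complex_def)
  qed
qed

lemma mod_relation_superset:
  assumes "finite \<tau>" "\<sigma> \<subseteq> \<tau>" "\<And>x. x \<in> \<tau> - \<sigma> \<Longrightarrow> int p dvd a x"
  shows "mod_relation p r f \<tau> a \<longleftrightarrow> mod_relation p r f \<sigma> a"
proof -
  have "(\<Sum>x\<in>\<tau>. a x * f x j) = (\<Sum>x\<in>\<tau> - \<sigma>. a x * f x j) + (\<Sum>x\<in>\<sigma>. a x * f x j)" for j
    using sum.subset_diff[OF assms(2,1)] .
  moreover have "int p dvd (\<Sum>x\<in>\<tau> - \<sigma>. a x * f x j)" for j
    using assms(3) by (intro dvd_sum) auto
  ultimately show ?thesis
    by (simp add: mod_relation_def dvd_add_right_iff)
qed

text \<open>A relation among at most \<open>k + 1\<close> vertices extends by zero to a relation among all of them, and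
  conversely a relation of weight at most \<open>k + 1\<close> restricts to its support, which is a simplex.\<close>

lemma nondegenerate_skeleton_iff_min_weight:
  assumes p: "prime p"
  shows "nondegenerate_map (simplex_skeleton m k) (universal_complex p r) f \<longleftrightarrow>
         f ` {1..m + 1} \<subseteq> carrier (Fp_space p r) \<and>
         (\<forall>a. mod_relation p r f {1..m + 1} a \<longrightarrow> mod_support p {1..m + 1} a \<noteq> {} \<longrightarrow>
              k + 2 \<le> card (mod_support p {1..m + 1} a))" (is "?L \<longleftrightarrow> ?C \<and> ?R")
proof -
  have fin: "finite \<sigma>" if "\<sigma> \<in> simplex_skeleton m k" for \<sigma>
    using that finite_subset[of \<sigma> "{1..m + 1}"] by (simp add: simplex_skeleton_def)
  have sub: "\<sigma> \<subseteq> {1..m + 1}" "card \<sigma> < k + 2" if "\<sigma> \<in> simplex_skeleton m k" for \<sigma>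
    using that by (auto simp: simplex_skeleton_def)
  show ?thesis
  proof
    assume L: ?L
    then have fv: "f \<in> {1..m + 1} \<rightarrow> carrier (Fp_space p r) - {\<zero>\<^bsub>Fp_space p r\<^esub>}"
      unfolding nondegenerate_map_def simplicial_map_def vertices_universal[OF p] vertices_skeleton
      by blast
    have ?R
    proof (intro allI impI)
      fix a assume rel: "mod_relation p r f {1..m + 1} a" and ne: "mod_support p {1..m + 1} a \<noteq> {}"
      let ?\<sigma> = "mod_support p {1..m + 1} a"
      show "k + 2 \<le> card ?\<sigma>"
      proof (rule ccontr)
        assume "\<not> k + 2 \<le> card ?\<sigma>"
        then have \<sigma>: "?\<sigma> \<in> simplex_skeleton m k"
          by (auto simp: simplex_skeleton_def mod_support_def)
        have C: "f ` ?\<sigma> \<subseteq> carrier (Fp_space p r)"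
          using fv by (auto simp: mod_support_def)
        have "inj_on f ?\<sigma> \<and> f ` ?\<sigma> \<in> universal_complex p r"
          using L \<sigma> by (simp add: nondegenerate_map_def simplicial_map_def)
        then have indep: "\<forall>b. mod_relation p r f ?\<sigma> b \<longrightarrow> (\<forall>x\<in>?\<sigma>. int p dvd b x)"
          by (rule iffD1[OF independent_family_iff[OF p fin[OF \<sigma>] C]])
        have "mod_relation p r f ?\<sigma> a"
          by (rule iffD1[OF mod_relation_superset rel]) (auto simp: mod_support_def)
        then have dvd: "\<forall>x\<in>?\<sigma>. int p dvd a x" by (rule mp[OF spec[OF indep, of a]])
        obtain x where x: "x \<in> ?\<sigma>" using ne by (meson ex_in_conv)
        then have "\<not> int p dvd a x" by (simp add: mod_support_def)
        with bspec[OF dvd x] show False by contradiction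
      qed
    qed
    with fv show "?C \<and> ?R" by auto
  next
    assume CR: "?C \<and> ?R"
    have good: "inj_on f \<sigma> \<and> f ` \<sigma> \<in> universal_complex p r" if \<sigma>: "\<sigma> \<in> simplex_skeleton m k" for \<sigma>
    proof -
      have "int p dvd a x" if rel: "mod_relation p r f \<sigma> a" and x: "x \<in> \<sigma>" for a x
      proof (rule ccontr)
        assume n: "\<not> int p dvd a x"
        define a' where "a' y = (if y \<in> \<sigma> then a y else 0)" for y
        have "mod_relation p r f \<sigma> a'"
          using rel by (simp add: mod_relation_def a'_def)
        then have "mod_relation p r f {1..m + 1} a'"
          using mod_relation_superset[of "{1..m + 1}" \<sigma> p a' r f] sub(1)[OF \<sigma>]
          by (simp add: a'_def)
        moreover have "x \<in> mod_support p {1..m + 1} a'"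
          using x n sub(1)[OF \<sigma>] by (auto simp: mod_support_def a'_def)
        ultimately have "k + 2 \<le> card (mod_support p {1..m + 1} a')"
          using CR by blast
        also have "\<dots> \<le> card \<sigma>"
          using fin[OF \<sigma>] by (intro card_mono) (auto simp: mod_support_def a'_def split: if_splits)
        finally show False using sub(2)[OF \<sigma>] by simp
      qed
      moreover have "f ` \<sigma> \<subseteq> carrier (Fp_space p r)" using CR sub(1)[OF \<sigma>] by blast
      ultimately show ?thesis
        using independent_family_iff[OF p fin[OF \<sigma>]] by blast
    qed
    have "f i \<in> vertices (universal_complex p r)" if "i \<in> {1..m + 1}" for i
    proof -
      have "{i} \<in> simplex_skeleton m k" using that by (simp add: simplex_skeleton_def)
      from good[OF this] show ?thesis by (auto simp: vertices_def)
    qed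
    then show ?L
      using good by (auto simp: nondegenerate_map_def simplicial_map_def vertices_skeleton)
  qed
qed

section \<open>The upper bound on the minimum weight\<close>

text \<open>Counting replaces linear algebra: the map sending coefficients to their linear combination has
  a fibre of at least \<open>p\<^sup>2\<close> elements, and differences inside this fibre are relations. Since a line
  through a point of the fibre has only \<open>p\<close> points, some difference is not a multiple of another.\<close>

lemma two_independent_relations:
  fixes I :: "'a set"
  assumes p: "prime p" and I: "finite I" and r: "r + 2 \<le> card I"
  obtains c d where "mod_relation p r f I c" "mod_relation p r f I d"
    "mod_support p I c \<noteq> {}" "\<And>t. mod_support p I (\<lambda>i. d i + t * c i) \<noteq> {}"
proof -
  have p1: "p > 1" using p by (rule prime_gt_1_nat)
  define A where "A = (I \<rightarrow>\<^sub>E {0..<int p})"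
  define B where "B = ({..<r} \<rightarrow>\<^sub>E {0..<int p})"
  define \<Phi> where "\<Phi> a = (\<lambda>j\<in>{..<r}. (\<Sum>x\<in>I. a x * f x j) mod int p)" for a
  have cardA: "card A = p ^ card I" and cardB: "card B = p ^ r"
    and finB: "finite B"
    using I by (simp_all add: A_def B_def card_PiE finite_PiE)
  have \<Phi>: "\<Phi> \<in> A \<rightarrow> B" using p1 by (auto simp: \<Phi>_def B_def)
  define F where "F b = {a\<in>A. \<Phi> a = b}" for b
  have "\<exists>b\<in>B. p\<^sup>2 \<le> card (F b)"
  proof (rule ccontr)
    assume "\<not> ?thesis"
    then have small: "card (F b) \<le> p\<^sup>2 - 1" if "b \<in> B" for b using that by fastforce
    have "A = (\<Union>b\<in>B. F b)" using \<Phi> by (auto simp: F_def)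
    then have "card A \<le> (\<Sum>b\<in>B. card (F b))" using card_UN_le[OF finB, of F] by simp
    also have "\<dots> \<le> p ^ r * (p\<^sup>2 - 1)" using sum_bounded_above[of B, OF small] by (simp add: cardB)
    also have "\<dots> < p ^ r * p\<^sup>2" using p1 by (intro mult_strict_left_mono) auto
    also have "\<dots> = p ^ (r + 2)" by (simp only: power_add)
    also have "\<dots> \<le> p ^ card I" using p1 r by (intro power_increasing) auto
    finally show False by (simp add: cardA)
  qed
  then obtain b where b: "p\<^sup>2 \<le> card (F b)" by blast
  have relation: "mod_relation p r f I (\<lambda>i. a i - a' i)" if "a \<in> F b" "a' \<in> F b" for a a'
  proof -
    have "int p dvd (\<Sum>x\<in>I. (a x - a' x) * f x j)" if "j < r" for j
    proof -
      have "\<Phi> a j = \<Phi> a' j" using \<open>a \<in> F b\<close> \<open>a' \<in> F b\<close> by (simp add: F_def)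
      then show ?thesis using that
        by (simp add: \<Phi>_def left_diff_distrib sum_subtractf mod_eq_dvd_iff)
    qed
    then show ?thesis by (simp add: mod_relation_def)
  qed
  have pp: "p < p\<^sup>2" using p1 by (simp add: power2_eq_square)
  have residues_eq: "a = a'"
    if "a \<in> A" "a' \<in> A" "\<And>i. i \<in> I \<Longrightarrow> int p dvd a i - a' i" for a a'
  proof (rule PiE_ext[OF that(1,2)[unfolded A_def]])
    fix i assume i: "i \<in> I"
    then have "a i mod int p = a' i mod int p" using that(3) by (simp add: mod_eq_dvd_iff)
    moreover have "a i \<in> {0..<int p}" "a' i \<in> {0..<int p}" using that(1,2) i by (auto simp: A_def)
    ultimately show "a i = a' i" by simp
  qed
  have FA: "F b \<subseteq> A" by (auto simp: F_def)
  \<comment> \<open>Three points of the fibre that are not on a line give two independent differences.\<close>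
  obtain a0 where a0: "a0 \<in> F b" using b pp by fastforce
  have "\<not> F b \<subseteq> {a0}" using card_mono[of "{a0}" "F b"] b pp p1 by auto
  then obtain a1 where a1: "a1 \<in> F b" "a1 \<noteq> a0" by blast
  define c where "c i = a1 i - a0 i" for i
  define line where "line t = (\<lambda>i\<in>I. (a0 i + t * c i) mod int p)" for t
  have lineA: "line t \<in> A" for t using p1 by (auto simp: line_def A_def)
  have "card (line ` {0..<int p}) \<le> p" using card_image_le[of "{0..<int p}" line] by simp
  then have "\<not> F b \<subseteq> line ` {0..<int p}"
    using card_mono[of "line ` {0..<int p}" "F b"] b pp by auto
  then obtain a2 where a2: "a2 \<in> F b" "a2 \<notin> line ` {0..<int p}" by blast
  have line_mod: "line (t mod int p) = line t" for t
  proof -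
    have "(a0 i + (t mod int p) * c i) mod int p = (a0 i + t * c i) mod int p" for i
      by (metis mod_add_right_eq mod_mult_left_eq)
    then show ?thesis by (simp add: line_def)
  qed
  have not_line: "a2 \<noteq> line t" for t
  proof
    assume "a2 = line t"
    then have "a2 = line (t mod int p)" by (simp only: line_mod)
    moreover have "t mod int p \<in> {0..<int p}" using p1 by simp
    ultimately show False using a2(2) by blast
  qed
  define d where "d i = a2 i - a0 i" for i
  show thesis
  proof
    show "mod_relation p r f I c" "mod_relation p r f I d"
      using relation[OF a1(1) a0] relation[OF a2(1) a0]
      by (simp_all only: c_def[abs_def] d_def[abs_def])
    show "mod_support p I c \<noteq> {}"
      using residues_eq[of a1 a0] a0 a1 FA by (auto simp: mod_support_def c_def)
    show "mod_support p I (\<lambda>i. d i + t * c i) \<noteq> {}" for t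
    proof
      assume e: "mod_support p I (\<lambda>i. d i + t * c i) = {}"
      have "a2 = line (- t)"
      proof (rule residues_eq)
        fix i assume i: "i \<in> I"
        then have "int p dvd a2 i - (a0 i + (- t) * c i)"
          using e by (auto simp: mod_support_def d_def algebra_simps)
        then have "a2 i mod int p = (a0 i + (- t) * c i) mod int p"
          by (simp add: mod_eq_dvd_iff)
        then show "int p dvd a2 i - line (- t) i"
          using i by (simp add: line_def mod_eq_dvd_iff[symmetric])
      qed (use a2 FA lineA in auto)
      with not_line show False by blast
    qed
  qed
qed

text \<open>Count the nonzero entries of the \<open>p + 1\<close> words \<open>c\<close> and \<open>d + t c\<close> in two ways: by words there
  are at least \<open>w\<close> for each, by positions at most \<open>p\<close> for each, since some word vanishes there.\<close>

lemma plotkin_bound: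
  fixes c d :: "'a \<Rightarrow> int"
  assumes p: "prime p" and I: "finite I"
    and c: "w \<le> card (mod_support p I c)"
    and d: "\<And>t. w \<le> card (mod_support p I (\<lambda>i. d i + t * c i))"
  shows "(p + 1) * w \<le> p * card I"
proof -
  \<comment> \<open>Index \<open>p\<close> plays the role of \<open>t = \<infinity>\<close>.\<close>
  define W where "W s = (if s = p then c else (\<lambda>i. d i + int s * c i))" for s
  have vanish: "\<exists>s\<le>p. int p dvd W s i" for i
  proof (cases "int p dvd c i")
    case True
    then show ?thesis by (intro exI[of _ p]) (simp add: W_def)
  next
    case False
    then have "coprime (c i) (int p)"
      using p prime_imp_coprime[of "int p" "c i"] by (simp add: coprime_commute)
    \<comment> \<open>The word \<open>d + t c\<close> vanishes at \<open>i\<close> for \<open>t = - d i / c i\<close>.\<close>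
    then obtain u where "[c i * u = 1] (mod int p)" using cong_solve_coprime_int by blast
    define t where "t = nat ((- d i * u) mod int p)"
    have p0: "int p > 0" using p by (simp add: prime_gt_0_nat)
    have t: "int t = (- d i * u) mod int p" using p0 by (simp add: t_def)
    have "t < p" using p0 pos_mod_bound[of "int p"] t by (metis of_nat_less_iff)
    have "[d i + int t * c i = d i + (- d i * u) * c i] (mod int p)"
      by (intro cong_add cong_mult cong_refl) (simp add: t)
    also have "d i + (- d i * u) * c i = d i - d i * (c i * u)" by (simp add: algebra_simps)
    also have "[\<dots> = d i - d i * 1] (mod int p)"
      using \<open>[c i * u = 1] (mod int p)\<close> by (intro cong_diff cong_mult cong_refl)
    finally have "int p dvd d i + int t * c i" by (simp add: cong_0_iff)
    then show ?thesis using \<open>t < p\<close> by (intro exI[of _ t]) (simp add: W_def)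
  qed
  have "(p + 1) * w = (\<Sum>s\<le>p. w)" by simp
  also have "\<dots> \<le> (\<Sum>s\<le>p. card (mod_support p I (W s)))"
    using c d by (intro sum_mono) (simp add: W_def)
  also have "\<dots> = (\<Sum>s\<le>p. \<Sum>i\<in>I. if \<not> int p dvd W s i then 1 else 0)"
    by (simp only: card_eq_sum mod_support_def sum.inter_filter[OF I])
  also have "\<dots> = (\<Sum>i\<in>I. \<Sum>s\<le>p. if \<not> int p dvd W s i then 1 else 0)"
    by (rule sum.swap)
  also have "\<dots> \<le> (\<Sum>i\<in>I. p)"
  proof (rule sum_mono)
    fix i
    obtain s where s: "s \<le> p" "int p dvd W s i" using vanish by blast
    have "(\<Sum>s\<le>p. if \<not> int p dvd W s i then 1 else 0) = card {s\<in>{..p}. \<not> int p dvd W s i}"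
      by (simp only: card_eq_sum sum.inter_filter[OF finite_atMost])
    also have "\<dots> \<le> card ({..p} - {s})" using s by (intro card_mono) auto
    also have "\<dots> = p" using s by simp
    finally show "(\<Sum>s\<le>p. if \<not> int p dvd W s i then 1 else 0) \<le> p" .
  qed
  finally show ?thesis by (simp add: mult.commute)
qed

section \<open>Codes of dimension two with large minimum weight\<close>

text \<open>Points \<open>(line_x p s, line_y p s)\<close> running cyclically through representatives
  \<open>(1, 0), (0, 1), (1, 1), \<dots>, (1, p - 1)\<close> of the \<open>p + 1\<close> lines of the plane over \<open>\<int>/p\<int>\<close>. The
  sequence starts with the standard basis so that a linear form is given by its first two values.\<close>

definition line_x :: "nat \<Rightarrow> nat \<Rightarrow> int" where
  "line_x p s = (if s mod (p + 1) = 1 then 0 else 1)"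

definition line_y :: "nat \<Rightarrow> nat \<Rightarrow> int" where
  "line_y p s = (if s mod (p + 1) \<le> 1 then int (s mod (p + 1)) else int (s mod (p + 1)) - 1)"

lemma line_det_not_dvd:
  assumes p: "prime p" and ne: "s mod (p + 1) \<noteq> t mod (p + 1)"
  shows "\<not> int p dvd line_x p s * line_y p t - line_x p t * line_y p s" (is "\<not> _ dvd ?D")
proof
  assume dvd: "int p dvd ?D"
  have p1: "p > 1" using p by (rule prime_gt_1_nat)
  define u v where "u = s mod (p + 1)" and "v = t mod (p + 1)"
  note uv = u_def[symmetric] v_def[symmetric]
  have "u \<le> p" "v \<le> p" "u \<noteq> v"
    using ne by (simp_all add: u_def v_def)
  then have "?D \<noteq> 0" "\<bar>?D\<bar> < int p"
    unfolding line_x_def line_y_def uv using p1 by (auto simp: le_Suc_eq)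
  then show False using dvd zdvd_imp_le[of "int p" "\<bar>?D\<bar>"] by simp
qed

text \<open>A linear form vanishing at points of two different lines is zero by Cramer's rule. Hence a
  nonzero form vanishes only at positions of a single residue class modulo \<open>p + 1\<close>.\<close>

lemma card_zeros_linear_form:
  assumes p: "prime p" and nz: "\<not> (int p dvd a \<and> int p dvd b)"
  shows "card {s. s \<le> m \<and> int p dvd a * line_x p s + b * line_y p s} \<le> m div (p + 1) + 1"
    (is "card ?Z \<le> _")
proof -
  have same: "s mod (p + 1) = t mod (p + 1)" if "s \<in> ?Z" "t \<in> ?Z" for s t
  proof (rule ccontr)
    assume ne: "\<not> ?thesis"
    let ?D = "line_x p s * line_y p t - line_x p t * line_y p s"
    have st: "int p dvd a * line_x p s + b * line_y p s" "int p dvd a * line_x p t + b * line_y p t"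
      using that by auto
    have "a * ?D = (a * line_x p s + b * line_y p s) * line_y p t
                 - (a * line_x p t + b * line_y p t) * line_y p s"
      and "b * ?D = (a * line_x p t + b * line_y p t) * line_x p s
                 - (a * line_x p s + b * line_y p s) * line_x p t"
      by (simp_all add: algebra_simps)
    then have "int p dvd a * ?D" "int p dvd b * ?D"
      using st by (simp_all add: dvd_diff)
    with line_det_not_dvd[OF p ne] have "int p dvd a" "int p dvd b"
      using p by (auto simp: prime_dvd_mult_iff)
    with nz show False by blast
  qed
  have "inj_on (\<lambda>s. s div (p + 1)) ?Z"
  proof (rule inj_onI)
    fix s t assume st: "s \<in> ?Z" "t \<in> ?Z" "s div (p + 1) = t div (p + 1)"
    have "s = s div (p + 1) * (p + 1) + s mod (p + 1)" by (rule div_mult_mod_eq[symmetric])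
    also have "\<dots> = t div (p + 1) * (p + 1) + t mod (p + 1)"
      by (simp only: st(3) same[OF st(1,2)])
    also have "\<dots> = t" by (rule div_mult_mod_eq)
    finally show "s = t" .
  qed
  moreover have "(\<lambda>s. s div (p + 1)) ` ?Z \<subseteq> {..m div (p + 1)}"
    by (auto intro: div_le_mono)
  ultimately have "card ?Z \<le> card {..m div (p + 1)}"
    by (intro card_inj_on_le) auto
  then show ?thesis by simp
qed

text \<open>The parity check matrix of the code of linear forms: vertex \<open>j + 3\<close> is sent to the \<open>j\<close>-th unit
  vector, and the vertices \<open>1\<close> and \<open>2\<close> to vectors chosen such that the \<open>j\<close>-th coordinate of a
  relation \<open>a\<close> expresses \<open>a (j + 3)\<close> as the linear form \<open>(a 1, a 2)\<close> at the point \<open>j + 2\<close>.\<close>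

definition check_vector :: "nat \<Rightarrow> nat \<Rightarrow> nat \<Rightarrow> nat \<Rightarrow> int" where
  "check_vector p r i = (\<lambda>j\<in>{..<r}.
     if i = 1 then (- line_x p (j + 2)) mod int p
     else if i = 2 then (- line_y p (j + 2)) mod int p
     else if i = j + 3 then 1 else 0)"

lemma check_vector_carrier:
  assumes "prime p"
  shows "check_vector p r i \<in> carrier (Fp_space p r)"
  using prime_gt_1_nat[OF assms] by (auto simp: carrier_Fp[OF assms] check_vector_def)

lemma relation_check_vector:
  assumes p: "prime p" and m: "m \<ge> 1" and s: "s \<le> m"
    and rel: "mod_relation p (m - 1) (check_vector p (m - 1)) {1..m + 1} a"
  shows "[a (s + 1) = a 1 * line_x p s + a 2 * line_y p s] (mod int p)"
proof -
  have p1: "p > 1" using p by (rule prime_gt_1_nat)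
  consider "s = 0" | "s = 1" | j where "s = j + 2" "j < m - 1"
    using s by (cases s rule: nat.exhaust; cases "s - 1") auto
  then show ?thesis
  proof cases
    case 1
    then show ?thesis by (simp add: line_x_def line_y_def)
  next
    case 2
    then show ?thesis using p1 by (simp add: line_x_def line_y_def numeral_2_eq_2)
  next
    case (3 j)
    let ?f = "check_vector p (m - 1)"
    let ?x = "line_x p s" and ?y = "line_y p s"
    have split: "{1..m + 1} = insert 1 (insert 2 {3..m + 1})" using m by auto
    have "(\<Sum>i\<in>{3..m + 1}. a i * ?f i j) = (\<Sum>i\<in>{3..m + 1}. if i = j + 3 then a i else 0)"
      using 3(2) by (intro sum.cong) (auto simp: check_vector_def)
    also have "\<dots> = a (j + 3)"
    proof -
      have "j + 3 \<in> {3..m + 1}" using 3(2) by simp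
      then show ?thesis by (simp only: sum.delta finite_atLeastAtMost if_True)
    qed
    also have "\<dots> = a (s + 1)" using 3(1) by (simp add: eval_nat_numeral)
    finally have tail: "(\<Sum>i\<in>{3..m + 1}. a i * ?f i j) = a (s + 1)" .
    have "(\<Sum>i\<in>{1..m + 1}. a i * ?f i j)
        = a 1 * ?f 1 j + (a 2 * ?f 2 j + (\<Sum>i\<in>{3..m + 1}. a i * ?f i j))"
      unfolding split by (simp del: sum.cl_ivl_Suc)
    also have "\<dots> = a 1 * ((- ?x) mod int p) + (a 2 * ((- ?y) mod int p) + a (s + 1))"
      unfolding tail using 3 by (simp add: check_vector_def)
    finally have "[a 1 * ((- ?x) mod int p) + (a 2 * ((- ?y) mod int p) + a (s + 1)) = 0] (mod int p)"
      using rel 3(2) unfolding mod_relation_def cong_0_iff by metis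
    moreover have "[a 1 * ((- ?x) mod int p) + (a 2 * ((- ?y) mod int p) + a (s + 1))
        = a 1 * (- ?x) + (a 2 * (- ?y) + a (s + 1))] (mod int p)"
      by (intro cong_add cong_mult cong_refl) auto
    ultimately have "[a 1 * (- ?x) + (a 2 * (- ?y) + a (s + 1)) = 0] (mod int p)"
      using cong_sym cong_trans by blast
    then have "int p dvd a (s + 1) - (a 1 * ?x + a 2 * ?y)"
      by (simp add: cong_0_iff algebra_simps)
    then show ?thesis by (simp add: cong_iff_dvd_diff)
  qed
qed

lemma ex_nondegenerate_of_bound:
  assumes p: "prime p" and m: "m \<ge> 1" and bound: "(p + 1) * (k + 2) \<le> p * (m + 1)"
  shows "\<exists>f. nondegenerate_map (simplex_skeleton m k) (universal_complex p (m - 1)) f"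
proof -
  let ?f = "check_vector p (m - 1)" and ?I = "{1..m + 1}"
  have "k + 2 \<le> card (mod_support p ?I a)"
    if rel: "mod_relation p (m - 1) ?f ?I a" and ne: "mod_support p ?I a \<noteq> {}" for a
  proof -
    have form: "int p dvd a (s + 1) \<longleftrightarrow> int p dvd a 1 * line_x p s + a 2 * line_y p s" if "s \<le> m" for s
      using relation_check_vector[OF p m that rel] by (simp add: cong_def dvd_eq_mod_eq_0)
    have nz: "\<not> (int p dvd a 1 \<and> int p dvd a 2)"
    proof
      assume "int p dvd a 1 \<and> int p dvd a 2"
      then have "int p dvd a (s + 1)" if "s \<le> m" for s using form[OF that] by simp
      then have "int p dvd a i" if "i \<in> ?I" for i
        using that by (metis Suc_eq_plus1 Suc_le_mono atLeastAtMost_iff le_add_diff_inverse2)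
      with ne show False by (auto simp: mod_support_def)
    qed
    let ?Z = "{s. s \<le> m \<and> int p dvd a 1 * line_x p s + a 2 * line_y p s}"
    have "?I - mod_support p ?I a = (\<lambda>s. s + 1) ` ?Z"
    proof (intro equalityI subsetI)
      fix i assume i: "i \<in> ?I - mod_support p ?I a"
      then have "i - 1 \<in> ?Z" "i = (i - 1) + 1" using form[of "i - 1"] by (auto simp: mod_support_def)
      then show "i \<in> (\<lambda>s. s + 1) ` ?Z" by (rule rev_image_eqI)
    next
      fix i assume "i \<in> (\<lambda>s. s + 1) ` ?Z"
      then show "i \<in> ?I - mod_support p ?I a" using form by (auto simp: mod_support_def)
    qed
    then have "card (?I - mod_support p ?I a) = card ?Z"
      by (simp add: card_image)
    moreover have "card ?I = card (?I - mod_support p ?I a) + card (mod_support p ?I a)"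
    proof -
      have "mod_support p ?I a \<subseteq> ?I" by (auto simp: mod_support_def)
      from sum.subset_diff[OF this finite_atLeastAtMost] show ?thesis unfolding card_eq_sum .
    qed
    ultimately have "m + 1 \<le> m div (p + 1) + 1 + card (mod_support p ?I a)"
      using card_zeros_linear_form[OF p nz, of m] by simp
    moreover have "k + 2 + m div (p + 1) \<le> m"
    proof -
      have "(p + 1) * (m div (p + 1)) \<le> m" by (rule times_div_less_eq_dividend)
      then have "(p + 1) * (k + 2 + m div (p + 1)) \<le> p * (m + 1) + m"
        using bound by (simp add: algebra_simps)
      also have "\<dots> < (p + 1) * (m + 1)" by (simp add: algebra_simps)
      finally have "k + 2 + m div (p + 1) < m + 1" by (simp only: mult_less_cancel1)
      then show ?thesis by simp
    qed
    ultimately show ?thesis by simp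
  qed
  then have "nondegenerate_map (simplex_skeleton m k) (universal_complex p (m - 1)) ?f"
    using check_vector_carrier[OF p] by (subst nondegenerate_skeleton_iff_min_weight[OF p]) blast
  then show ?thesis by blast
qed

section \<open>The threshold\<close>

lemma buchstaber_ge_2_iff:
  assumes p: "prime p" and m: "m \<ge> 1"
  shows "buchstaber_mod p (simplex_skeleton m k) \<ge> 2 \<longleftrightarrow> (p + 1) * (k + 2) \<le> p * (m + 1)"
proof -
  let ?P = "\<lambda>r. \<exists>f. nondegenerate_map (simplex_skeleton m k) (universal_complex p r) f"
  have "\<exists>r. ?P r"
    using ex_nondegenerate_map[OF p simplicial_complex_skeleton, of m k]
    by (simp add: vertices_skeleton)
  then have least: "?P (LEAST r. ?P r)" by (rule LeastI_ex)
  have "buchstaber_mod p (simplex_skeleton m k) \<ge> 2 \<longleftrightarrow> (LEAST r. ?P r) + 2 \<le> m + 1"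
    by (simp add: buchstaber_mod_def vertices_skeleton) linarith
  also have "\<dots> \<longleftrightarrow> (p + 1) * (k + 2) \<le> p * (m + 1)"
  proof
    assume r: "(LEAST r. ?P r) + 2 \<le> m + 1"
    obtain f where f: "nondegenerate_map (simplex_skeleton m k) (universal_complex p (LEAST r. ?P r)) f"
      using least by blast
    obtain c d where cd: "mod_relation p (LEAST r. ?P r) f {1..m + 1} c"
        "mod_relation p (LEAST r. ?P r) f {1..m + 1} d"
        "mod_support p {1..m + 1} c \<noteq> {}"
        "\<And>t. mod_support p {1..m + 1} (\<lambda>i. d i + t * c i) \<noteq> {}"
      using two_independent_relations[OF p, of "{1..m + 1}" "LEAST r. ?P r" f] r by auto
    have "mod_relation p (LEAST r. ?P r) f {1..m + 1} (\<lambda>i. d i + t * c i)" for t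
    proof -
      have "(\<Sum>i\<in>{1..m + 1}. (d i + t * c i) * f i j)
          = (\<Sum>i\<in>{1..m + 1}. d i * f i j) + t * (\<Sum>i\<in>{1..m + 1}. c i * f i j)" for j
        by (simp only: distrib_right sum.distrib sum_distrib_left mult.assoc)
      then show ?thesis using cd(1,2) by (simp add: mod_relation_def)
    qed
    then have "(p + 1) * (k + 2) \<le> p * card {1..m + 1}"
      using cd f nondegenerate_skeleton_iff_min_weight[OF p]
      by (intro plotkin_bound[OF p, of _ _ c d]) blast+
    then show "(p + 1) * (k + 2) \<le> p * (m + 1)" by simp
  next
    assume "(p + 1) * (k + 2) \<le> p * (m + 1)"
    then have "?P (m - 1)" by (rule ex_nondegenerate_of_bound[OF p m])
    then have "(LEAST r. ?P r) \<le> m - 1" by (rule Least_le)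
    then show "(LEAST r. ?P r) + 2 \<le> m + 1" using m by simp
  qed
  finally show ?thesis .
qed

text \<open>The bound says \<open>m + 1 \<ge> (k + 2) + \<lceil>(k + 2) / p\<rceil>\<close>, and the ceiling is \<open>k div p + 1\<close> unless
  \<open>k\<close> has remainder \<open>p - 1\<close>, in which case \<open>k + 2\<close> has passed one more multiple of \<open>p\<close>.\<close>

lemma griesmer_threshold:
  fixes p k m :: nat
  assumes p: "p > 1"
  shows "(p + 1) * (k + 2) \<le> p * (m + 1) \<longleftrightarrow>
         (if k mod p = p - 1 then k + k div p + 3 \<le> m else k + k div p + 2 \<le> m)"
proof -
  define q where "q = k div p"
  define e where "e = k mod p"
  have k: "k = p * q + e" by (simp add: q_def e_def)
  have e: "e < p" using p by (simp add: e_def)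
  have le: "(p + 1) * (k + 2) \<le> p * (m + 1) \<longleftrightarrow> p * (k + q + 1) + e + 2 \<le> p * m"
    by (simp add: k algebra_simps)
  show ?thesis
  proof (cases "e = p - 1")
    case True
    have "p * (k + q + 1) + e + 2 \<le> p * m \<longleftrightarrow> p * (k + q + 2) < p * m"
      using True p by (auto simp: algebra_simps)
    also have "\<dots> \<longleftrightarrow> k + q + 2 < m" using p by (simp only: mult_less_cancel1) simp
    also have "\<dots> \<longleftrightarrow> k + q + 3 \<le> m" by linarith
    finally show ?thesis using True le by (simp add: q_def e_def)
  next
    case False
    have "p * (k + q + 1) + e + 2 \<le> p * m \<longleftrightarrow> k + q + 2 \<le> m"
    proof
      assume "p * (k + q + 1) + e + 2 \<le> p * m"
      then have "p * (k + q + 1) < p * m" by linarith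
      then have "k + q + 1 < m" by (simp only: mult_less_cancel1)
      then show "k + q + 2 \<le> m" by simp
    next
      assume "k + q + 2 \<le> m"
      then have "p * (k + q + 2) \<le> p * m" by (rule mult_le_mono2)
      then show "p * (k + q + 1) + e + 2 \<le> p * m" using False e by (simp add: algebra_simps)
    qed
    then show ?thesis using False le by (simp add: q_def e_def)
  qed
qed

theorem proposition3p7:
  fixes p m k :: nat
  assumes "prime p" and "m \<ge> 2" and "k \<le> m"
  shows "(\<not> [k = p - 1] (mod p) \<longrightarrow>
            (buchstaber_mod p (simplex_skeleton m k) \<ge> 2 \<longleftrightarrow> m \<ge> k + k div p + 2)) \<and>
         ([k = p - 1] (mod p) \<longrightarrow>
            (buchstaber_mod p (simplex_skeleton m k) \<ge> 2 \<longleftrightarrow> m \<ge> k + k div p + 3))"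
proof -
  have p1: "p > 1" using assms(1) by (rule prime_gt_1_nat)
  then have "[k = p - 1] (mod p) \<longleftrightarrow> k mod p = p - 1" by (simp add: cong_def)
  moreover have "buchstaber_mod p (simplex_skeleton m k) \<ge> 2 \<longleftrightarrow> (p + 1) * (k + 2) \<le> p * (m + 1)"
    using assms(1,2) by (intro buchstaber_ge_2_iff) auto
  ultimately show ?thesis using griesmer_threshold[OF p1, of k m] by simp
qed

end
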